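(* Let $n\ge 1$ and $d\ge 2$ be integers, let $A$ be a $d$-dimensional $(0,1)$-matrix of order $n$, and let $l_\beta$, $\beta\in I_n^{d-1}$, be the $1$-dimensional planes of some fixed direction in $A$, where $\beta$ is the vector of values of the $d-1$ fixed indices. Suppose that the sum of the entries in the plane $l_\beta$ is equal to $r_\beta$. Consider the $(d-1)$-dimensional matrix $B=(b_\beta)_{\beta\in I_n^{d-1}}$ of order $n$ with $b_\beta=(r_\beta!)^{1/r_\beta}$, where $b_\beta=0$ if $r_\beta=0$. Then $$\operatorname{per}A\leq\operatorname{per}B.$$
   Context: Let $I_n^d=\{(\alpha_1,\dots,\alpha_d):\alpha_i\in\{1,\dots,n\}\}$. A $d$-dimensional matrix $A$ of order $n$ is a real array $(a_\alpha)_{\alpha\in I_n^d}$; it is a $(0,1)$-matrix if every entry is $0$ or $1$. A $1$-dimensional plane in $A$ is the set of entries obtained by fixing $d-1$ of the indices and letting the remaining one vary from $1$ to $n$; its direction specifies which indices are fixed. A diagonal of a $d$-dimensional matrix $A$ of order $n$ is a set of $n$ indices $\{\alpha^1,\dots,\alpha^n\}\subset I_n^d$ such that any two distinct ones differ in all $d$ positions (Hamming distance $d$). The permanent of $A$ is $\operatorname{per}A=\sum_{p}\prod_{\alpha\in p}a_\alpha$, the sum over all diagonals $p$ of $A$. (For $d=1$ there is a single diagonal, so the permanent is the product of all entries.) *)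

theory Defs
  imports Complex_Main
begin

text \<open>
  A multi-index in \<open>I\<^sub>n\<^sup>d\<close> is a list of length \<open>d\<close> with entries in \<open>{1..n}\<close>; positions in it are
  counted from 0. A \<open>d\<close>-dimensional matrix of order \<open>n\<close> is a function on such lists, whose values
  outside \<open>multi_indices n d\<close> are irrelevant.
\<close>

definition multi_indices :: "nat \<Rightarrow> nat \<Rightarrow> nat list set" where
  "multi_indices n d = {\<alpha>. length \<alpha> = d \<and> set \<alpha> \<subseteq> {1..n}}"

definition zero_one_matrix :: "nat \<Rightarrow> nat \<Rightarrow> (nat list \<Rightarrow> real) \<Rightarrow> bool" where
  "zero_one_matrix n d A \<longleftrightarrow> (\<forall>\<alpha>\<in>multi_indices n d. A \<alpha> = 0 \<or> A \<alpha> = 1)"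

text \<open>
  The direction of a 1-dimensional plane is given by the position \<open>k\<close> of its free index; \<open>\<beta>\<close> lists
  the values of the fixed indices in order.
\<close>

definition line :: "nat \<Rightarrow> nat \<Rightarrow> nat list \<Rightarrow> nat list set" where
  "line n k \<beta> = {take k \<beta> @ j # drop k \<beta> | j. j \<in> {1..n}}"

definition diagonals :: "nat \<Rightarrow> nat \<Rightarrow> nat list set set" where
  "diagonals n d = {p. p \<subseteq> multi_indices n d \<and> card p = n \<and>
     (\<forall>\<alpha>\<in>p. \<forall>\<beta>\<in>p. \<alpha> \<noteq> \<beta> \<longrightarrow> (\<forall>i<d. \<alpha> ! i \<noteq> \<beta> ! i))}"

definition permanent :: "nat \<Rightarrow> nat \<Rightarrow> (nat list \<Rightarrow> real) \<Rightarrow> real" where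
  "permanent n d A = (\<Sum>p\<in>diagonals n d. \<Prod>\<alpha>\<in>p. A \<alpha>)"

end

theory Submission
  imports Defs "HOL-Library.FuncSet"
begin

text \<open>
  Deleting the free coordinate \<open>k\<close> maps a diagonal of \<open>A\<close> to a diagonal \<open>q\<close> of \<open>B\<close>, and the diagonals
  of \<open>A\<close> with product \<open>1\<close> over \<open>q\<close> correspond to the injective choices of one nonzero entry from each
  line \<open>l\<^sub>\<beta>\<close>, \<open>\<beta> \<in> q\<close>. Their number is the permanent of an \<open>n \<times> n\<close> \<open>(0,1)\<close>-matrix
  with row sums \<open>r\<^sub>\<beta>\<close>, so Bregman's theorem bounds it by the product of \<open>B\<close> over \<open>q\<close>.
  Bregman's theorem itself is proved following Schrijver: expand the permanent \<open>N\<close> along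
  every row \<open>i\<close>, bound \<open>N ln N\<close> by Gibbs' inequality, apply the induction hypothesis to the minors and
  exchange the order of summation.
\<close>

section \<open>Bregman's theorem\<close>

text \<open>With as many columns as rows, the number of these choices is the permanent of the
  (0,1)-matrix with row supports \<open>R i\<close>. \<open>PiE\<close> pins the values outside
  \<open>I\<close>, so counting functions counts choices.\<close>

definition transversals :: "'a set \<Rightarrow> ('a \<Rightarrow> 'b set) \<Rightarrow> ('a \<Rightarrow> 'b) set" where
  "transversals I R = {f \<in> PiE I R. inj_on f I}"

lemma finite_transversals:
  assumes "finite I" and "\<And>i. i \<in> I \<Longrightarrow> finite (R i)"
  shows "finite (transversals I R)"
  using finite_PiE[of I R] assms by (simp add: transversals_def)

text \<open>Expansion along row \<open>i\<close>: choosing column \<open>u\<close> there deletes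
  that row and that column. Restriction to \<open>I - {i}\<close> and the update at \<open>i\<close>
  are mutually inverse.\<close>

lemma card_transversals_fixed:
  assumes "i \<in> I" and "u \<in> R i"
  shows "card {f \<in> transversals I R. f i = u} = card (transversals (I - {i}) (\<lambda>j. R j - {u}))"
proof -
  let ?F = "\<lambda>f. restrict f (I - {i})" and ?G = "\<lambda>g. g(i := u)"
  have "\<forall>f\<in>{f \<in> transversals I R. f i = u}. ?G (?F f) = f"
    using assms by (auto simp: transversals_def PiE_def extensional_def fun_eq_iff)
  moreover have "\<forall>g\<in>transversals (I - {i}) (\<lambda>j. R j - {u}). ?F (?G g) = g"
    by (auto simp: transversals_def PiE_def extensional_def fun_eq_iff)
  moreover have "?F ` {f \<in> transversals I R. f i = u} \<subseteq> transversals (I - {i}) (\<lambda>j. R j - {u})"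
    using assms by (auto simp: transversals_def PiE_def Pi_def inj_on_def)
  moreover have "?G ` transversals (I - {i}) (\<lambda>j. R j - {u}) \<subseteq> {f \<in> transversals I R. f i = u}"
  proof (rule image_subsetI)
    fix g assume "g \<in> transversals (I - {i}) (\<lambda>j. R j - {u})"
    then have g: "g \<in> PiE (I - {i}) (\<lambda>j. R j - {u})" "inj_on g (I - {i})"
      by (simp_all add: transversals_def)
    have "?G g \<in> PiE I R"
      using g(1) assms by (auto simp: PiE_def Pi_def extensional_def)
    moreover have "u \<notin> g ` (I - {i})" using g(1) by auto
    then have "inj_on (?G g) (insert i (I - {i}))"
      using inj_on_fun_updI[OF g(2), of u i] unfolding inj_on_insert by auto
    ultimately show "?G g \<in> {f \<in> transversals I R. f i = u}"
      using assms(1) by (simp add: transversals_def insert_absorb)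
  qed
  ultimately show ?thesis
    by (rule bij_betw_same_card[OF bij_betw_byWitness])
qed

text \<open>Gibbs' inequality for the distribution of \<open>g\<close> on \<open>S\<close> against
  the uniform one on \<open>C\<close>. It is meant for \<open>g\<close> evaluating a transversal at
  one row, where the fibre sizes are the permanents of minors.\<close>

lemma sum_ln_fibre_card_ge:
  fixes g :: "'a \<Rightarrow> 'b"
  assumes "finite S" and "S \<noteq> {}" and "finite C" and "g ` S \<subseteq> C"
  shows "real (card S) * (ln (card S) - ln (card C))
           \<le> (\<Sum>f\<in>S. ln (card {h \<in> S. g h = g f}))"
proof -
  define t where "t u = real (card {h \<in> S. g h = u})" for u
  define N where "N = real (card S)"
  define c where "c = real (card C)"
  have N: "N > 0" using assms by (simp add: N_def card_gt_0_iff)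
  have c: "c > 0" using assms by (auto simp: c_def card_gt_0_iff)
  have t: "t (g f) > 0" if "f \<in> S" for f
    using that assms(1) by (auto simp: t_def card_gt_0_iff)
  have "(\<Sum>f\<in>S. 1 / t (g f)) = (\<Sum>u\<in>g ` S. \<Sum>f\<in>{f \<in> S. g f = u}. 1 / t (g f))"
    using assms(1) by (rule sum.image_gen)
  \<comment> \<open>Each of the \<open>t u\<close> elements of a fibre contributes
    \<open>1 / t u\<close>, so the sum counts the values of \<open>g\<close>.\<close>
  also have "\<dots> = (\<Sum>u\<in>g ` S. 1)"
  proof (rule sum.cong)
    fix u assume "u \<in> g ` S"
    then have "t u > 0" using t by auto
    then show "(\<Sum>f\<in>{f \<in> S. g f = u}. 1 / t (g f)) = 1" by (simp add: t_def)
  qed simp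
  also have "\<dots> \<le> c"
    using card_mono[OF assms(3,4)] by (simp add: c_def)
  finally have inv: "(\<Sum>f\<in>S. 1 / t (g f)) \<le> c" .
  have "N * (ln N - ln c) - (\<Sum>f\<in>S. ln (t (g f))) = (\<Sum>f\<in>S. ln N - ln c - ln (t (g f)))"
    by (simp add: sum_subtractf sum.distrib N_def algebra_simps)
  \<comment> \<open>Uses \<open>ln x \<le> x - 1\<close> at \<open>x = N / (c * t (g f))\<close>; by
    \<open>inv\<close> the resulting sum is at most 0.\<close>
  also have "\<dots> \<le> (\<Sum>f\<in>S. N / c * (1 / t (g f)) - 1)"
  proof (rule sum_mono)
    fix f assume "f \<in> S"
    then have "ln N - ln c - ln (t (g f)) = ln (N / (c * t (g f)))"
      using N c t[OF \<open>f \<in> S\<close>] by (simp add: ln_div ln_mult)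
    also have "\<dots> \<le> N / (c * t (g f)) - 1"
      using N c t[OF \<open>f \<in> S\<close>] by (intro ln_le_minus_one) simp
    finally show "ln N - ln c - ln (t (g f)) \<le> N / c * (1 / t (g f)) - 1" by simp
  qed
  also have "\<dots> = N / c * (\<Sum>f\<in>S. 1 / t (g f)) - N"
    by (simp only: sum_subtractf flip: sum_distrib_left) (simp add: N_def)
  also have "\<dots> \<le> N / c * c - N"
    using inv N c by (intro diff_right_mono mult_left_mono) auto
  also have "\<dots> = 0" using c by simp
  finally show ?thesis by (simp add: N_def c_def t_def)
qed

text \<open>
  For \<open>r = 0\<close> the junk value \<open>ln (fact 0) / 0 = 0\<close> is not the logarithm of the factor \<open>0\<close> assigned to
  an empty row; but then there are no transversals.
\<close>

lemma ln_card_transversals_le: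
  assumes "finite I" and "finite U" and "card U = card I" and "\<And>i. i \<in> I \<Longrightarrow> R i \<subseteq> U"
    and "transversals I R \<noteq> {}"
  shows "ln (card (transversals I R)) \<le> (\<Sum>i\<in>I. ln (fact (card (R i))) / card (R i))"
  using assms
proof (induction "card I" arbitrary: I U R)
  case 0
  then show ?case by (simp add: transversals_def PiE_empty_domain)
next
  case (Suc n)
  define S where "S = transversals I R"
  define N where "N = card S"
  define r where "r i = card (R i)" for i
  define L where "L m = ln (fact m) / real m" for m :: nat
  have finR: "finite (R i)" if "i \<in> I" for i
    using Suc.prems(2,4) that finite_subset by blast
  have finS: "finite S" unfolding S_def using Suc.prems(1) finR by (rule finite_transversals)
  have "S \<noteq> {}" using Suc.prems(5) by (simp add: S_def)
  then have "N > 0" using finS by (simp add: N_def card_gt_0_iff)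
  have memR: "f i \<in> R i" if "f \<in> S" "i \<in> I" for f i
    using that by (auto simp: S_def transversals_def)
  have r_pos: "r i > 0" if "i \<in> I" for i
    using \<open>S \<noteq> {}\<close> memR that finR by (auto simp: r_def card_gt_0_iff)
  \<comment> \<open>The matrix is square, so a transversal uses every column; this later turns sums
    over rows into sums over columns.\<close>
  have bij: "bij_betw f I U" if "f \<in> S" for f
  proof -
    have inj: "inj_on f I" using that by (simp add: S_def transversals_def)
    have "f ` I \<subseteq> U" using memR[OF that] Suc.prems(4) by auto
    then have "f ` I = U"
      using Suc.prems(2,3) card_image[OF inj] by (intro card_subset_eq) auto
    then show ?thesis using inj by (simp add: bij_betw_def)
  qed
  have expand: "real N * (ln N - ln (r i)) \<le> (\<Sum>f\<in>S. ln (card {h \<in> S. h i = f i}))"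
    if "i \<in> I" for i
    unfolding N_def r_def
    using finS \<open>S \<noteq> {}\<close> finR[OF that] memR that by (intro sum_ln_fibre_card_ge) auto
  \<comment> \<open>The induction hypothesis for the minor without row \<open>i\<close> and column
    \<open>f i\<close>. It has a transversal because \<open>f\<close> lies in the fibre, and row
    \<open>j\<close> loses an entry exactly when \<open>f i \<in> R j\<close>.\<close>
  have minor: "ln (card {h \<in> S. h i = f i})
        \<le> (\<Sum>j\<in>I - {i}. if f i \<in> R j then L (r j - 1) else L (r j))"
    if "f \<in> S" "i \<in> I" for f i
  proof -
    let ?R = "\<lambda>j. R j - {f i}"
    have eq: "card {h \<in> S. h i = f i} = card (transversals (I - {i}) ?R)"
      unfolding S_def using that memR by (intro card_transversals_fixed) auto
    have "f \<in> {h \<in> S. h i = f i}" using that by simp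
    then have "card {h \<in> S. h i = f i} \<noteq> 0" using finS by auto
    then have ne: "transversals (I - {i}) ?R \<noteq> {}" using eq by auto
    have "f i \<in> U" using memR that Suc.prems(4) by blast
    then have "ln (card (transversals (I - {i}) ?R))
        \<le> (\<Sum>j\<in>I - {i}. ln (fact (card (?R j))) / card (?R j))"
      using Suc.hyps(2) Suc.prems that ne by (intro Suc.hyps(1)[where U = "U - {f i}"]) auto
    also have "\<dots> = (\<Sum>j\<in>I - {i}. if f i \<in> R j then L (r j - 1) else L (r j))"
      by (intro sum.cong) (auto simp: L_def r_def)
    finally show ?thesis by (simp add: eq)
  qed
  \<comment> \<open>As \<open>i\<close> runs over the rows other than \<open>j\<close>,
    \<open>f i\<close> runs over the columns other than \<open>f j\<close>: \<open>r j - 1\<close>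
    of them lie in \<open>R j\<close> and \<open>Suc n - r j\<close> do not. The total is thus
    independent of \<open>f\<close>.\<close>
  have count: "(\<Sum>i\<in>I - {j}. if f i \<in> R j then L (r j - 1) else L (r j))
      = ln (fact (r j - 1)) + real (Suc n - r j) * L (r j)"
    if "f \<in> S" "j \<in> I" for f j
  proof -
    have b: "bij_betw f (I - {j}) (U - {f j})"
      using bij[OF that(1)] that(2) by (auto simp: bij_betw_def inj_on_def)
    have "(\<Sum>i\<in>I - {j}. if f i \<in> R j then L (r j - 1) else L (r j))
        = (\<Sum>u\<in>U - {f j}. if u \<in> R j then L (r j - 1) else L (r j))"
      by (rule sum.reindex_bij_betw[OF b])
    also have "\<dots> = (\<Sum>u\<in>(U - {f j}) \<inter> {u. u \<in> R j}. L (r j - 1))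
                  + (\<Sum>u\<in>(U - {f j}) \<inter> - {u. u \<in> R j}. L (r j))"
      using Suc.prems(2) by (intro sum.If_cases) auto
    also have "(U - {f j}) \<inter> {u. u \<in> R j} = R j - {f j}"
      using Suc.prems(4)[OF that(2)] by auto
    also have "(U - {f j}) \<inter> - {u. u \<in> R j} = U - R j"
      using memR[OF that] by auto
    finally have "(\<Sum>i\<in>I - {j}. if f i \<in> R j then L (r j - 1) else L (r j))
        = real (card (R j - {f j})) * L (r j - 1) + real (card (U - R j)) * L (r j)"
      by simp
    moreover have "card (R j - {f j}) = r j - 1"
      using memR[OF that] by (simp add: r_def)
    moreover have "card (U - R j) = Suc n - r j"
      using Suc.prems(3) Suc.prems(4)[OF that(2)] Suc.hyps(2) finR[OF that(2)]
      by (simp add: card_Diff_subset r_def)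
    \<comment> \<open>For \<open>r j = 1\<close> both sides are 0, whatever value \<open>L 0\<close>
      has.\<close>
    moreover have "real (r j - 1) * L (r j - 1) = ln (fact (r j - 1))"
      by (cases "r j - 1 = 0") (simp_all add: L_def)
    ultimately show ?thesis by simp
  qed
  \<comment> \<open>The first two terms give \<open>ln (fact (r j))\<close>, which is
    \<open>r j\<close> copies of \<open>L (r j)\<close>; the last term brings the number of copies
    to \<open>Suc n\<close>.\<close>
  have row: "ln (r j) + (ln (fact (r j - 1)) + real (Suc n - r j) * L (r j)) = real (Suc n) * L (r j)"
    if "j \<in> I" for j
  proof -
    have "r j \<le> Suc n"
      using card_mono[OF Suc.prems(2) Suc.prems(4)[OF that]] Suc.prems(3) Suc.hyps(2)
      by (simp add: r_def)
    moreover have "ln (r j) + ln (fact (r j - 1)) = ln (fact (r j) :: real)"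
      using r_pos[OF that] by (simp add: fact_reduce[of "r j"] ln_mult)
    moreover have "real (r j) * L (r j) = ln (fact (r j))"
      using r_pos[OF that] by (simp add: L_def)
    ultimately show ?thesis
      by (simp add: of_nat_diff left_diff_distrib)
  qed
  \<comment> \<open>Expanding along all \<open>Suc n\<close> rows at once yields
    \<open>Suc n\<close> copies of \<open>N * ln N\<close>, matching the \<open>Suc n\<close> copies
    of each \<open>L (r j)\<close>.\<close>
  have "real N * (real (Suc n) * ln N) - real N * (\<Sum>i\<in>I. ln (r i))
      = (\<Sum>i\<in>I. real N * (ln N - ln (r i)))"
    by (simp add: sum_subtractf Suc.hyps(2)[symmetric] right_diff_distrib flip: sum_distrib_left)
  also have "\<dots> \<le> (\<Sum>i\<in>I. \<Sum>f\<in>S. ln (card {h \<in> S. h i = f i}))"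
    by (intro sum_mono expand)
  also have "\<dots> \<le> (\<Sum>i\<in>I. \<Sum>f\<in>S. \<Sum>j\<in>I - {i}. if f i \<in> R j then L (r j - 1) else L (r j))"
    by (intro sum_mono minor)
  also have "\<dots> = (\<Sum>f\<in>S. \<Sum>i\<in>I. \<Sum>j\<in>I - {i}. if f i \<in> R j then L (r j - 1) else L (r j))"
    by (rule sum.swap)
  also have "\<dots> = (\<Sum>f\<in>S. \<Sum>j\<in>I. \<Sum>i\<in>I - {j}. if f i \<in> R j then L (r j - 1) else L (r j))"
  proof (rule sum.cong)
    fix f
    \<comment> \<open>Both double sums run over the ordered pairs of distinct rows.\<close>
    have swap: "I - {i} = {j \<in> I. i \<noteq> j}" for i by auto
    show "(\<Sum>i\<in>I. \<Sum>j\<in>I - {i}. if f i \<in> R j then L (r j - 1) else L (r j))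
        = (\<Sum>j\<in>I. \<Sum>i\<in>I - {j}. if f i \<in> R j then L (r j - 1) else L (r j))"
      unfolding swap
      by (subst sum.swap_restrict[OF Suc.prems(1) Suc.prems(1)]) (simp add: eq_commute)
  qed simp
  also have "\<dots> = real N * (\<Sum>j\<in>I. ln (fact (r j - 1)) + real (Suc n - r j) * L (r j))"
    by (simp add: count N_def)
  finally have "real N * (real (Suc n) * ln N)
      \<le> real N * (\<Sum>j\<in>I. ln (r j) + (ln (fact (r j - 1)) + real (Suc n - r j) * L (r j)))"
    by (simp add: sum.distrib algebra_simps)
  also have "\<dots> = real N * (real (Suc n) * (\<Sum>j\<in>I. L (r j)))"
    by (simp only: row sum_distrib_left cong: sum.cong)
  finally have "ln N \<le> (\<Sum>j\<in>I. L (r j))"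
    using \<open>N > 0\<close> by (simp del: of_nat_Suc)
  then show ?case by (simp add: N_def S_def L_def r_def)
qed

text \<open>Exponentiates the logarithmic bound, which requires a transversal; without one the left
  side is 0 and the product is nonnegative.\<close>

theorem bregman:
  assumes "finite I" and "finite U" and "card U = card I" and "\<And>i. i \<in> I \<Longrightarrow> R i \<subseteq> U"
  shows "real (card (transversals I R))
    \<le> (\<Prod>i\<in>I. if card (R i) = 0 then 0 else fact (card (R i)) powr (1 / card (R i)))"
proof (cases "transversals I R = {}")
  case True
  then show ?thesis by (simp add: prod_nonneg)
next
  case False
  have finR: "finite (R i)" if "i \<in> I" for i
    using assms(2,4) that finite_subset by blast
  have "R i \<noteq> {}" if "i \<in> I" for i
    using False that by (auto simp: transversals_def)
  then have "card (R i) \<noteq> 0" if "i \<in> I" for i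
    using finR that by simp
  then have "(\<Prod>i\<in>I. if card (R i) = 0 then 0 else fact (card (R i)) powr (1 / card (R i)))
      = (\<Prod>i\<in>I. exp (ln (fact (card (R i))) / card (R i)))"
    by (intro prod.cong) (auto simp: powr_def)
  also have "\<dots> = exp (\<Sum>i\<in>I. ln (fact (card (R i))) / card (R i))"
    using assms(1) by (simp add: exp_sum)
  finally have *: "(\<Prod>i\<in>I. if card (R i) = 0 then 0 else fact (card (R i)) powr (1 / card (R i)))
      = exp (\<Sum>i\<in>I. ln (fact (card (R i))) / card (R i))" .
  have "card (transversals I R) > 0"
    using False finite_transversals[OF assms(1) finR] by (simp add: card_gt_0_iff)
  then have "real (card (transversals I R)) = exp (ln (card (transversals I R)))"
    by simp
  also have "\<dots> \<le> exp (\<Sum>i\<in>I. ln (fact (card (R i))) / card (R i))"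
    using ln_card_transversals_le[OF assms False] by simp
  finally show ?thesis using * by simp
qed

section \<open>Deleting a coordinate\<close>

text \<open>Parametrises \<open>line n k \<beta>\<close> by its free coordinate.\<close>

definition insert_at :: "nat \<Rightarrow> nat list \<Rightarrow> nat \<Rightarrow> nat list" where
  "insert_at k \<beta> j = take k \<beta> @ j # drop k \<beta>"

definition delete_at :: "nat \<Rightarrow> nat list \<Rightarrow> nat list" where
  "delete_at k \<alpha> = take k \<alpha> @ drop (Suc k) \<alpha>"

lemma insert_delete_at: "k < length \<alpha> \<Longrightarrow> insert_at k (delete_at k \<alpha>) (\<alpha> ! k) = \<alpha>"
  by (simp add: insert_at_def delete_at_def id_take_nth_drop[symmetric])

lemma inj_insert_at: "inj (insert_at k \<beta>)"
  by (auto simp: inj_def insert_at_def)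

lemma nth_delete_at:
  "k < length \<alpha> \<Longrightarrow> i < length \<alpha> - 1 \<Longrightarrow> delete_at k \<alpha> ! i = \<alpha> ! (if i < k then i else Suc i)"
  by (auto simp: delete_at_def nth_append min_def)

lemma delete_at_multi_indices:
  assumes "\<alpha> \<in> multi_indices n d" and "k < d"
  shows "delete_at k \<alpha> \<in> multi_indices n (d - 1)"
  using assms set_take_subset[of k \<alpha>] set_drop_subset[of "Suc k" \<alpha>]
  by (auto simp: multi_indices_def delete_at_def)

lemma finite_multi_indices: "finite (multi_indices n d)"
proof -
  have "multi_indices n d = {xs. set xs \<subseteq> {1..n} \<and> length xs = d}"
    by (auto simp: multi_indices_def)
  then show ?thesis by (simp add: finite_lists_length_eq)
qed

lemma finite_diagonals: "finite (diagonals n d)"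
proof (rule finite_subset)
  show "diagonals n d \<subseteq> Pow (multi_indices n d)" by (auto simp: diagonals_def)
qed (simp add: finite_multi_indices)

text \<open>With no remaining coordinate all indices of a diagonal would collapse, hence \<open>d \<ge> 2\<close>.\<close>

lemma inj_on_delete_at:
  assumes "p \<in> diagonals n d" and "k < d" and "d \<ge> 2"
  shows "inj_on (delete_at k) p"
proof (rule inj_onI, rule ccontr)
  fix \<alpha> \<alpha>' assume *: "\<alpha> \<in> p" "\<alpha>' \<in> p" "delete_at k \<alpha> = delete_at k \<alpha>'" "\<alpha> \<noteq> \<alpha>'"
  then have "length \<alpha> = d" "length \<alpha>' = d"
    using assms(1) by (auto simp: diagonals_def multi_indices_def)
  \<comment> \<open>The position in the original index of the first coordinate that survives the
    deletion.\<close>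
  then have "\<alpha> ! (if 0 < k then 0 else Suc 0) = \<alpha>' ! (if 0 < k then 0 else Suc 0)"
    using assms(2,3) *(3) nth_delete_at[of k \<alpha> 0] nth_delete_at[of k \<alpha>' 0] by simp
  moreover have "(if 0 < k then 0 else Suc 0) < d" using assms(3) by simp
  ultimately show False using * assms(1) by (auto simp: diagonals_def)
qed

text \<open>Every coordinate of a shortened index is a coordinate of the original, so distinct
  members still differ everywhere; injectivity keeps the cardinality \<open>n\<close>.\<close>

lemma delete_at_diagonals:
  assumes "p \<in> diagonals n d" and "k < d" and "d \<ge> 2"
  shows "delete_at k ` p \<in> diagonals n (d - 1)"
proof -
  have p: "p \<subseteq> multi_indices n d" "card p = n" using assms(1) by (auto simp: diagonals_def)
  have "delete_at k \<alpha> ! i \<noteq> delete_at k \<alpha>' ! i"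
    if "\<alpha> \<in> p" "\<alpha>' \<in> p" "delete_at k \<alpha> \<noteq> delete_at k \<alpha>'" "i < d - 1" for \<alpha> \<alpha>' i
  proof -
    have "length \<alpha> = d" "length \<alpha>' = d" using that p(1) by (auto simp: multi_indices_def)
    moreover have "\<alpha> \<noteq> \<alpha>'" using that(3) by blast
    then have "\<alpha> ! m \<noteq> \<alpha>' ! m" if "m < d" for m
      using that \<open>\<alpha> \<in> p\<close> \<open>\<alpha>' \<in> p\<close> assms(1) by (auto simp: diagonals_def)
    ultimately show ?thesis using that(4) assms(2) by (simp add: nth_delete_at)
  qed
  then show ?thesis
    using p delete_at_multi_indices[OF _ assms(2)] card_image[OF inj_on_delete_at[OF assms]]
    by (auto simp: diagonals_def)
qed

section \<open>Lines as rows of a square (0,1)-matrix\<close>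

definition line_support :: "nat \<Rightarrow> nat \<Rightarrow> (nat list \<Rightarrow> real) \<Rightarrow> nat list \<Rightarrow> nat set" where
  "line_support n k A \<beta> = {j \<in> {1..n}. A (insert_at k \<beta> j) = 1}"

text \<open>The transversal sends each shortened index to the coordinate deleted from its unique
  preimage in \<open>p\<close>. It is injective because members of a diagonal that agree at position
  \<open>k\<close> are equal.\<close>

lemma diagonal_from_transversal:
  assumes p: "p \<in> diagonals n d" and kd: "k < d" "d \<ge> 2" and one: "\<And>\<alpha>. \<alpha> \<in> p \<Longrightarrow> A \<alpha> = 1"
  shows "p \<in> (\<lambda>f. (\<lambda>\<beta>. insert_at k \<beta> (f \<beta>)) ` (delete_at k ` p))
              ` transversals (delete_at k ` p) (line_support n k A)"
proof (rule image_eqI)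
  define f where "f = restrict (\<lambda>\<beta>. inv_into p (delete_at k) \<beta> ! k) (delete_at k ` p)"
  have inj: "inj_on (delete_at k) p" using p kd by (rule inj_on_delete_at)
  have f: "f (delete_at k \<alpha>) = \<alpha> ! k" if "\<alpha> \<in> p" for \<alpha>
    using that inj by (simp add: f_def)
  have ins: "insert_at k (delete_at k \<alpha>) (f (delete_at k \<alpha>)) = \<alpha>" if "\<alpha> \<in> p" for \<alpha>
    using that p kd by (auto simp: f diagonals_def multi_indices_def insert_delete_at)
  show "p = (\<lambda>\<beta>. insert_at k \<beta> (f \<beta>)) ` (delete_at k ` p)"
    by (simp add: image_image ins)
  have "\<alpha> ! k \<in> {1..n}" if "\<alpha> \<in> p" for \<alpha>
  proof -
    have "set \<alpha> \<subseteq> {1..n}" "k < length \<alpha>"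
      using that p kd by (auto simp: diagonals_def multi_indices_def)
    then show ?thesis using nth_mem by blast
  qed
  then have "f (delete_at k \<alpha>) \<in> line_support n k A (delete_at k \<alpha>)" if "\<alpha> \<in> p" for \<alpha>
    using that ins[OF that] one[OF that] f[OF that] by (simp add: line_support_def)
  moreover have "inj_on f (delete_at k ` p)"
  proof (rule inj_onI)
    fix \<beta> \<beta>' assume "\<beta> \<in> delete_at k ` p" "\<beta>' \<in> delete_at k ` p" and eq: "f \<beta> = f \<beta>'"
    then obtain \<alpha> \<alpha>' where \<alpha>: "\<alpha> \<in> p" "\<beta> = delete_at k \<alpha>" "\<alpha>' \<in> p" "\<beta>' = delete_at k \<alpha>'"
      by blast
    then have "\<alpha> ! k = \<alpha>' ! k" using eq f by simp
    then have "\<alpha> = \<alpha>'" using p \<alpha> kd by (auto simp: diagonals_def)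
    then show "\<beta> = \<beta>'" using \<alpha> by simp
  qed
  moreover have "f \<in> extensional (delete_at k ` p)" by (simp add: f_def)
  ultimately show "f \<in> transversals (delete_at k ` p) (line_support n k A)"
    by (auto simp: transversals_def PiE_def)
qed

text \<open>Identifies the line sums of \<open>A\<close> with the row sizes in Bregman's
  theorem.\<close>

lemma card_line_support:
  assumes "zero_one_matrix n d A" and "k < d" and "\<beta> \<in> multi_indices n (d - 1)"
  shows "(\<Sum>\<alpha>\<in>line n k \<beta>. A \<alpha>) = real (card (line_support n k A \<beta>))"
proof -
  have line: "line n k \<beta> = insert_at k \<beta> ` {1..n}"
    by (auto simp: line_def insert_at_def)
  have A: "A (insert_at k \<beta> j) = of_bool (A (insert_at k \<beta> j) = 1)" if "j \<in> {1..n}" for j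
  proof -
    have "insert_at k \<beta> j \<in> multi_indices n d"
      using that assms(2,3) set_take_subset[of k \<beta>] set_drop_subset[of k \<beta>]
      by (auto simp: multi_indices_def insert_at_def)
    then show ?thesis using assms(1) by (auto simp: zero_one_matrix_def)
  qed
  have "(\<Sum>\<alpha>\<in>line n k \<beta>. A \<alpha>) = (\<Sum>j\<in>{1..n}. A (insert_at k \<beta> j))"
    unfolding line by (simp add: sum.reindex inj_on_subset[OF inj_insert_at])
  also have "\<dots> = (\<Sum>j\<in>{1..n}. of_bool (A (insert_at k \<beta> j) = 1))"
    using A by (rule sum.cong[OF refl])
  also have "\<dots> = real (card ({1..n} \<inter> {j. A (insert_at k \<beta> j) = 1}))"
    by simp
  also have "{1..n} \<inter> {j. A (insert_at k \<beta> j) = 1} = line_support n k A \<beta>"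
    by (auto simp: line_support_def)
  finally show ?thesis .
qed

section \<open>Counting diagonals and the final estimate\<close>

lemma permanent_zero_one:
  assumes "zero_one_matrix n d A"
  shows "permanent n d A = real (card {p \<in> diagonals n d. \<forall>\<alpha>\<in>p. A \<alpha> = 1})"
proof -
  have "(\<Prod>\<alpha>\<in>p. A \<alpha>) = of_bool (\<forall>\<alpha>\<in>p. A \<alpha> = 1)" if "p \<in> diagonals n d" for p
  proof -
    have p: "p \<subseteq> multi_indices n d" using that by (auto simp: diagonals_def)
    then have "finite p" using finite_multi_indices finite_subset by blast
    moreover have "A \<alpha> = 0 \<or> A \<alpha> = 1" if "\<alpha> \<in> p" for \<alpha>
      using assms p that by (auto simp: zero_one_matrix_def)
    ultimately show ?thesis by (auto intro!: prod_zero prod.neutral)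
  qed
  then have "permanent n d A = (\<Sum>p\<in>diagonals n d. of_bool (\<forall>\<alpha>\<in>p. A \<alpha> = 1))"
    unfolding permanent_def by (rule sum.cong[OF refl])
  also have "\<dots> = real (card (diagonals n d \<inter> {p. \<forall>\<alpha>\<in>p. A \<alpha> = 1}))"
    using finite_diagonals by simp
  also have "diagonals n d \<inter> {p. \<forall>\<alpha>\<in>p. A \<alpha> = 1} = {p \<in> diagonals n d. \<forall>\<alpha>\<in>p. A \<alpha> = 1}"
    by auto
  finally show ?thesis .
qed

theorem proposition3:
  fixes n d k :: nat
    and A B :: "nat list \<Rightarrow> real"
    and r :: "nat list \<Rightarrow> nat"
  assumes "n \<ge> 1" and "d \<ge> 2"
    and "zero_one_matrix n d A"
    and "k < d"
    and "\<And>\<beta>. \<beta> \<in> multi_indices n (d - 1) \<Longrightarrow> (\<Sum>\<alpha>\<in>line n k \<beta>. A \<alpha>) = real (r \<beta>)"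
    and "\<And>\<beta>. \<beta> \<in> multi_indices n (d - 1) \<Longrightarrow>
           B \<beta> = (if r \<beta> = 0 then 0 else fact (r \<beta>) powr (1 / real (r \<beta>)))"
  shows "permanent n d A \<le> permanent n (d - 1) B"
proof -
  let ?D = "diagonals n (d - 1)"
  let ?R = "line_support n k A"
  let ?lift = "\<lambda>q f. (\<lambda>\<beta>. insert_at k \<beta> (f \<beta>)) ` q"
  have card_R: "card (?R \<beta>) = r \<beta>" if "\<beta> \<in> multi_indices n (d - 1)" for \<beta>
    using card_line_support[OF assms(3,4) that] assms(5)[OF that] by simp
  have fin_q: "finite q" if "q \<in> ?D" for q
    using that finite_multi_indices finite_subset by (auto simp: diagonals_def)
  have fin: "finite (transversals q ?R)" if "q \<in> ?D" for q
    using fin_q[OF that] by (rule finite_transversals) (simp add: line_support_def)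
  \<comment> \<open>Bregman's theorem with rows \<open>q\<close> and columns \<open>{1..n}\<close>;
    the matrix is square since a diagonal has \<open>n\<close> members.\<close>
  have bound: "real (card (transversals q ?R)) \<le> (\<Prod>\<beta>\<in>q. B \<beta>)" if q: "q \<in> ?D" for q
  proof -
    have "real (card (transversals q ?R))
        \<le> (\<Prod>\<beta>\<in>q. if card (?R \<beta>) = 0 then 0 else fact (card (?R \<beta>)) powr (1 / card (?R \<beta>)))"
      using fin_q[OF q] q
      by (intro bregman[where U = "{1..n}"]) (auto simp: line_support_def diagonals_def)
    also have "\<dots> = (\<Prod>\<beta>\<in>q. B \<beta>)"
      using q assms(6) card_R by (intro prod.cong) (auto simp: diagonals_def)
    finally show ?thesis .
  qed
  have sub: "{p \<in> diagonals n d. \<forall>\<alpha>\<in>p. A \<alpha> = 1} \<subseteq> (\<Union>q\<in>?D. ?lift q ` transversals q ?R)"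
  proof
    fix p assume p: "p \<in> {p \<in> diagonals n d. \<forall>\<alpha>\<in>p. A \<alpha> = 1}"
    then have "delete_at k ` p \<in> ?D" using delete_at_diagonals assms(2,4) by simp
    moreover have "p \<in> ?lift (delete_at k ` p) ` transversals (delete_at k ` p) ?R"
      using p assms(2,4) by (intro diagonal_from_transversal) auto
    ultimately show "p \<in> (\<Union>q\<in>?D. ?lift q ` transversals q ?R)" by (rule UN_I)
  qed
  \<comment> \<open>For an upper bound a covering suffices: the union bound over \<open>q\<close>,
    then the bound on the size of an image.\<close>
  have "card {p \<in> diagonals n d. \<forall>\<alpha>\<in>p. A \<alpha> = 1} \<le> card (\<Union>q\<in>?D. ?lift q ` transversals q ?R)"
    using fin by (intro card_mono sub) (simp add: finite_diagonals)
  also have "\<dots> \<le> (\<Sum>q\<in>?D. card (?lift q ` transversals q ?R))"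
    by (rule card_UN_le) (rule finite_diagonals)
  also have "\<dots> \<le> (\<Sum>q\<in>?D. card (transversals q ?R))"
    using fin by (intro sum_mono card_image_le)
  finally have "permanent n d A \<le> real (\<Sum>q\<in>?D. card (transversals q ?R))"
    unfolding permanent_zero_one[OF assms(3)] by (rule of_nat_mono)
  also have "\<dots> \<le> permanent n (d - 1) B"
    unfolding permanent_def of_nat_sum by (intro sum_mono bound)
  finally show ?thesis .
qed

end
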